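(* Let $p>3$ be a prime and let $n$ be a positive integer. Then $$\frac{T_{pn}-T_n}{(pn)^2}\equiv\frac{T_{n-1}}{6}\left(\frac p3\right)B_{p-2}\left(\frac13\right)\pmod p.$$
   Context: For each integer $m\ge 0$, the central trinomial coefficient $T_m$ is the coefficient of $x^m$ in the expansion of $(x^2+x+1)^m$; equivalently $T_m=\sum_{k=0}^{\lfloor m/2\rfloor}\binom{m}{2k}\binom{2k}{k}$. $\left(\frac p3\right)$ is the Legendre symbol (equal to $1$ if $p\equiv1\pmod 3$ and $-1$ if $p\equiv 2\pmod 3$). $B_m(x)$ is the Bernoulli polynomial of degree $m$, defined by $\frac{te^{xt}}{e^t-1}=\sum_{m\ge0}B_m(x)\frac{t^m}{m!}$. $\mathbb Z_p$ denotes the ring of $p$-adic integers, and for rational numbers $a,b$ the congruence $a\equiv b\pmod p$ means $a-b\in p\mathbb Z_p$. *)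

theory Defs
  imports
    "HOL-Computational_Algebra.Computational_Algebra"
    "HOL-Number_Theory.Number_Theory"
begin

definition central_trinomial :: "nat \<Rightarrow> int" where
  "central_trinomial m = poly.coeff ([:1, 1, 1:] ^ m) m"

text \<open>
  The value at \<open>x\<close> of the \<open>m\<close>-th Bernoulli polynomial, from the generating function
  \<open>t e\<^sup>x\<^sup>t / (e\<^sup>t - 1)\<close>.  The denominator has zero constant term, so the division below is
  division in the Euclidean ring of formal power series over a field; it is exact because the
  denominator has subdegree 1 and the numerator is a multiple of \<open>t\<close>.
\<close>
definition bernpoly :: "nat \<Rightarrow> 'a :: field_char_0 \<Rightarrow> 'a" where
  "bernpoly m x = fact m * fps_nth (fps_X * fps_exp x / (fps_exp 1 - 1)) m"

lemma bernpoly_generating_function: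
  "Abs_fps (\<lambda>m. bernpoly m x / fact m) * (fps_exp 1 - 1) = fps_X * fps_exp (x :: 'a :: field_char_0)"
proof -
  let ?g = "fps_exp 1 - 1 :: 'a fps"
  have nz: "fps_nth ?g 1 \<noteq> 0" by simp
  hence g: "?g \<noteq> 0" by force
  have "subdegree ?g = 1"
    by (rule subdegreeI) (use nz in auto)
  hence "subdegree ?g \<le> subdegree (fps_X * fps_exp x)"
    by (simp add: subdegree_mult)
  hence "?g dvd fps_X * fps_exp x"
    using g by (subst fps_dvd_iff) auto
  moreover have "Abs_fps (\<lambda>m. bernpoly m x / fact m) = fps_X * fps_exp x / ?g"
    by (simp add: fps_eq_iff bernpoly_def)
  ultimately show ?thesis by simp
qed

text \<open>
  The \<open>p\<close>-adic valuation of a nonzero rational number; its value at 0 (which ought to be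
  \<open>\<infinity>\<close>) is meaningless.
\<close>
definition padic_val :: "nat \<Rightarrow> rat \<Rightarrow> int" where
  "padic_val p x = (case quotient_of x of (a, b) \<Rightarrow>
     int (multiplicity (int p) a) - int (multiplicity (int p) b))"

text \<open>
  The rational numbers lying in the ring of \<open>p\<close>-adic integers, i.e. the intersection of the
  rationals with \<open>\<int>\<^sub>p = {x \<in> \<rat>\<^sub>p. v\<^sub>p(x) \<ge> 0}\<close>.
\<close>
definition padic_int_rats :: "nat \<Rightarrow> rat set" where
  "padic_int_rats p = {x. x = 0 \<or> padic_val p x \<ge> 0}"

text \<open>
  For rational \<open>a\<close>, \<open>b\<close>: \<open>a - b \<in> p\<int>\<^sub>p\<close>.  The generic \<open>cong\<close> is of no use here, since it is
  trivial on the field of rationals.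
\<close>
definition rat_cong :: "rat \<Rightarrow> rat \<Rightarrow> nat \<Rightarrow> bool" where
  "rat_cong a b p \<longleftrightarrow> (\<exists>z \<in> padic_int_rats p. a - b = of_nat p * z)"

end

theory Submission
  imports Defs
begin

text \<open>
  Let \<open>w\<close> be a primitive cube root of unity. From \<open>x\<^sup>2 + x + 1 = (x - w) (x - w\<^sup>2)\<close> one reads off
  \<open>T\<^sub>n = (-1)\<^sup>n \<Sum>\<^sub>k (n choose k)\<^sup>2 w\<^sup>n\<^sup>+\<^sup>k\<close>, and taking traces turns this into the identity
  \<open>2 T\<^sub>n = (-1)\<^sup>n \<Sum>\<^sub>k (n choose k)\<^sup>2 e(n + k)\<close> between integers, where \<open>e(k) = w\<^sup>k + w\<^sup>-\<^sup>k\<close>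
  (\<open>two_central_trinomial\<close>). The binomial coefficients enter squared, and this is what produces
  the factor \<open>(pn)\<^sup>2\<close>, also when \<open>p\<close> divides \<open>n\<close>. Apply the identity to \<open>pn\<close> and split the sum
  according to whether \<open>p\<close> divides \<open>k\<close>.

  If \<open>k = pj\<close>, then \<open>(pn choose pj)\<^sup>2 / (n choose j)\<^sup>2\<close> is \<open>1\<close> plus a \<open>p\<close>-integral multiple of
  \<open>p\<^sup>3 n (n - j)\<close> (\<open>binomial_prime_multiple_square\<close>, a form of Wolstenholme's theorem). As
  \<open>(n - j) (n choose j) = n (n - 1 choose j)\<close>, these terms reproduce the sum for \<open>T\<^sub>n\<close> up to a
  multiple of \<open>p\<^sup>3 n\<^sup>2\<close>, and so contribute nothing modulo \<open>p\<close> after division by \<open>(pn)\<^sup>2\<close>.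

  If \<open>k = pj + r\<close> with \<open>0 < r < p\<close>, then \<open>(pn choose k) = (pn / k) (pn - 1 choose k - 1)\<close>, and the
  square of the last factor is congruent to \<open>(n - 1 choose j)\<^sup>2\<close> modulo \<open>p\<close>
  (\<open>binomial_coprime_index_square\<close>). For fixed \<open>r\<close> the sum over \<open>j\<close> is again a sum of the first
  kind, with value \<open>(-1)\<^sup>n\<^sup>-\<^sup>1 T\<^sub>n\<^sub>-\<^sub>1 e(p + r)\<close> (\<open>sum_trace_twisted\<close>). Hence the quotient in
  question is congruent to \<open>- T\<^sub>n\<^sub>-\<^sub>1 / 2\<close> times \<open>\<Sum>\<^sub>r e(p + r) / r\<^sup>2\<close>.

  Modulo \<open>p\<close> that remaining sum is a third of the sum of \<open>1 / k\<^sup>2\<close> over \<open>p / 3 < k < 2 p / 3\<close>. Since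
  \<open>1 / k\<^sup>2\<close> is congruent to \<open>k\<^sup>p\<^sup>-\<^sup>3\<close>, it is \<open>-1 / 2\<close> times a difference of values of the
  Bernoulli polynomial of degree \<open>p - 2\<close> at points congruent to \<open>1 / 3\<close> and \<open>2 / 3\<close>, and the
  reflection \<open>x \<mapsto> 1 - x\<close> changes the sign of this polynomial (\<open>sum_trace_inverse_squares\<close>).
\<close>

section \<open>Rational numbers that are integral at a prime\<close>

text \<open>
  Any fraction with denominator prime to \<open>p\<close> will do, reduced or not; in this form the closure
  under the ring operations is immediate.
\<close>

lemma padic_int_rats_iff:
  assumes "prime p"
  shows "x \<in> padic_int_rats p \<longleftrightarrow> (\<exists>a b. \<not> int p dvd b \<and> x = of_int a / of_int b)"
proof -
  obtain a b where ab: "quotient_of x = (a, b)"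
    by (cases "quotient_of x") auto
  have x: "x = of_int a / of_int b"
    using ab by (rule quotient_of_div)
  have b: "b > 0"
    using ab by (rule quotient_of_denom_pos)
  have cop: "coprime a b"
    using ab by (rule quotient_of_coprime)
  have pp: "prime (int p)"
    using assms by simp
  show ?thesis
  proof (cases "int p dvd b")
    case False
    hence "x \<in> padic_int_rats p"
      using ab by (simp add: padic_int_rats_def padic_val_def not_dvd_imp_multiplicity_0)
    thus ?thesis
      using x False by blast
  next
    case True
    hence na: "\<not> int p dvd a"
      using cop pp by (meson coprime_common_divisor not_prime_unit)
    hence "a \<noteq> 0"
      by auto
    hence "x \<noteq> 0"
      using x b by simp
    moreover have "multiplicity (int p) b \<noteq> 0"
      using True b pp by (subst multiplicity_eq_zero_iff) auto
    ultimately have "x \<notin> padic_int_rats p"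
      using ab na by (simp add: padic_int_rats_def padic_val_def not_dvd_imp_multiplicity_0)
    moreover have False if "\<not> int p dvd d" "x = of_int c / of_int d" for c d
    proof -
      have "d \<noteq> 0"
        using that by auto
      hence "of_int a * of_int d = (of_int c * of_int b :: rat)"
        using that x b by (simp add: field_simps)
      hence "a * d = c * b"
        by (metis of_int_eq_iff of_int_mult)
      hence "int p dvd a * d"
        using True by simp
      thus False
        using na that(1) pp by (simp add: prime_dvd_mult_iff)
    qed
    ultimately show ?thesis
      by blast
  qed
qed

context
  fixes p :: nat
  assumes prime_p: "prime p"
begin

lemma p_pos [simp]: "p > 0"
  using prime_p by (rule prime_gt_0_nat)

lemma padic_int_rats_fraction:
  "\<not> int p dvd b \<Longrightarrow> of_int a / of_int b \<in> padic_int_rats p"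
  using padic_int_rats_iff[OF prime_p] by blast

lemma padic_int_rats_of_int [simp]: "of_int a \<in> padic_int_rats p"
  using padic_int_rats_fraction[of 1 a] prime_p by (simp add: prime_nat_iff)

lemma padic_int_rats_of_nat [simp]: "of_nat a \<in> padic_int_rats p"
  using padic_int_rats_of_int[of "int a"] by simp

lemma padic_int_rats_numeral [simp]:
  "0 \<in> padic_int_rats p" "1 \<in> padic_int_rats p" "numeral k \<in> padic_int_rats p"
  using padic_int_rats_of_int[of 0] padic_int_rats_of_int[of 1]
    padic_int_rats_of_int[of "numeral k"] by simp_all

lemma padic_int_rats_inverse:
  "\<not> p dvd k \<Longrightarrow> 1 / of_nat k \<in> padic_int_rats p"
  using padic_int_rats_fraction[of "int k" 1] by simp

lemma padic_int_rats_add [intro]: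
  assumes "x \<in> padic_int_rats p" "y \<in> padic_int_rats p"
  shows "x + y \<in> padic_int_rats p"
proof -
  obtain a b c d where *: "\<not> int p dvd b" "x = of_int a / of_int b"
      "\<not> int p dvd d" "y = of_int c / of_int d"
    using assms padic_int_rats_iff[OF prime_p] by metis
  hence "b \<noteq> 0" "d \<noteq> 0" "\<not> int p dvd b * d"
    using prime_p by (auto simp: prime_dvd_mult_iff)
  moreover from this have "x + y = of_int (a * d + c * b) / of_int (b * d)"
    using * by (simp add: field_simps)
  ultimately show ?thesis
    using padic_int_rats_fraction by metis
qed

lemma padic_int_rats_mult [intro]:
  assumes "x \<in> padic_int_rats p" "y \<in> padic_int_rats p"
  shows "x * y \<in> padic_int_rats p"
proof -
  obtain a b c d where *: "\<not> int p dvd b" "x = of_int a / of_int b"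
      "\<not> int p dvd d" "y = of_int c / of_int d"
    using assms padic_int_rats_iff[OF prime_p] by metis
  hence "\<not> int p dvd b * d"
    using prime_p by (auto simp: prime_dvd_mult_iff)
  moreover have "x * y = of_int (a * c) / of_int (b * d)"
    using * by simp
  ultimately show ?thesis
    using padic_int_rats_fraction by metis
qed

lemma padic_int_rats_uminus [intro]: "x \<in> padic_int_rats p \<Longrightarrow> - x \<in> padic_int_rats p"
  using padic_int_rats_mult[OF padic_int_rats_of_int[of "-1"]] by simp

lemma padic_int_rats_diff [intro]:
  "x \<in> padic_int_rats p \<Longrightarrow> y \<in> padic_int_rats p \<Longrightarrow> x - y \<in> padic_int_rats p"
  using padic_int_rats_add[of x "- y"] by auto

lemma padic_int_rats_power [intro]: "x \<in> padic_int_rats p \<Longrightarrow> x ^ n \<in> padic_int_rats p"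
  by (induction n) auto

lemma padic_int_rats_sum [intro]:
  "(\<And>i. i \<in> I \<Longrightarrow> f i \<in> padic_int_rats p) \<Longrightarrow> sum f I \<in> padic_int_rats p"
  by (induction I rule: infinite_finite_induct) auto

lemma padic_int_rats_divide:
  "x \<in> padic_int_rats p \<Longrightarrow> \<not> p dvd k \<Longrightarrow> x / of_nat k \<in> padic_int_rats p"
  using padic_int_rats_mult[OF _ padic_int_rats_inverse, of x k] by simp

lemma rat_cong_iff: "rat_cong x y p \<longleftrightarrow> (x - y) / of_nat p \<in> padic_int_rats p"
proof -
  have "x - y = of_nat p * z \<longleftrightarrow> z = (x - y) / of_nat p" for z
    using p_pos by (auto simp: field_simps)
  thus ?thesis
    by (auto simp: rat_cong_def)
qed

lemma rat_congI: "z \<in> padic_int_rats p \<Longrightarrow> x - y = of_nat p * z \<Longrightarrow> rat_cong x y p"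
  by (auto simp: rat_cong_def)

lemma rat_cong_refl [simp]: "rat_cong x x p"
  by (simp add: rat_cong_iff)

lemma rat_cong_sym: "rat_cong x y p \<Longrightarrow> rat_cong y x p"
  using padic_int_rats_uminus[of "(x - y) / of_nat p"]
  by (simp add: rat_cong_iff minus_divide_left)

lemma rat_cong_trans [trans]: "rat_cong x y p \<Longrightarrow> rat_cong y z p \<Longrightarrow> rat_cong x z p"
  using padic_int_rats_add[of "(x - y) / of_nat p" "(y - z) / of_nat p"]
  by (simp add: rat_cong_iff flip: add_divide_distrib)

lemma rat_cong_add:
  "rat_cong x y p \<Longrightarrow> rat_cong x' y' p \<Longrightarrow> rat_cong (x + x') (y + y') p"
  using padic_int_rats_add[of "(x - y) / of_nat p" "(x' - y') / of_nat p"]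
  by (simp add: rat_cong_iff add_diff_add flip: add_divide_distrib)

lemma rat_cong_cmult:
  "rat_cong x y p \<Longrightarrow> c \<in> padic_int_rats p \<Longrightarrow> rat_cong (c * x) (c * y) p"
  using padic_int_rats_mult[of c "(x - y) / of_nat p"]
  by (simp add: rat_cong_iff right_diff_distrib)

lemma rat_cong_mult:
  assumes "rat_cong x y p" "rat_cong x' y' p" "x' \<in> padic_int_rats p" "y \<in> padic_int_rats p"
  shows "rat_cong (x * x') (y * y') p"
  using rat_cong_trans[OF rat_cong_cmult[OF assms(1,3)]] rat_cong_cmult[OF assms(2,4)]
  by (simp add: mult.commute)

lemma rat_cong_diff:
  "rat_cong x y p \<Longrightarrow> rat_cong x' y' p \<Longrightarrow> rat_cong (x - x') (y - y') p"
  using rat_cong_add[of x y "- x'" "- y'"] rat_cong_cmult[of x' y' "-1"]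
    padic_int_rats_of_int[of "-1"] by simp

lemma rat_cong_sum:
  "(\<And>i. i \<in> I \<Longrightarrow> rat_cong (f i) (g i) p) \<Longrightarrow> rat_cong (sum f I) (sum g I) p"
  by (induction I rule: infinite_finite_induct) (auto intro: rat_cong_add)

lemma rat_cong_power:
  "rat_cong x y p \<Longrightarrow> x \<in> padic_int_rats p \<Longrightarrow> y \<in> padic_int_rats p \<Longrightarrow>
    rat_cong (x ^ n) (y ^ n) p"
  by (induction n) (auto intro: rat_cong_mult)

lemma rat_cong_of_int: "[a = b] (mod int p) \<Longrightarrow> rat_cong (of_int a) (of_int b) p"
proof -
  assume "[a = b] (mod int p)"
  then obtain c where "a - b = int p * c"
    by (auto simp: cong_iff_dvd_diff)
  hence "of_int a - of_int b = (of_nat p * of_int c :: rat)"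
    by (metis of_int_diff of_int_mult of_int_of_nat_eq)
  thus ?thesis
    by (rule rat_congI[rotated]) simp
qed

lemma rat_cong_inverse:
  assumes "[a = b] (mod int p)" "\<not> int p dvd a"
  shows "rat_cong (1 / of_int a) (1 / of_int b) p"
proof -
  have b: "\<not> int p dvd b"
    using assms cong_dvd_iff by blast
  have nz: "of_int a \<noteq> (0::rat)" "of_int b \<noteq> (0::rat)"
    using assms b by auto
  have "1 / of_int a * (1 / of_int b) \<in> padic_int_rats p"
    using padic_int_rats_fraction[of a 1] padic_int_rats_fraction[of b 1] assms b
    by (intro padic_int_rats_mult) simp_all
  from rat_cong_cmult[OF rat_cong_of_int[OF assms(1)] this] nz
  have "rat_cong (1 / of_int b) (1 / of_int a) p"
    by simp
  thus ?thesis
    by (rule rat_cong_sym)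
qed

lemma inverse_square_cong_power:
  assumes "p > 3" "\<not> p dvd k"
  shows "rat_cong (1 / of_nat k ^ 2) (of_nat k ^ (p - 3)) p"
proof -
  have "[int (k ^ (p - 1)) = int 1] (mod int p)"
    using fermat_theorem[OF prime_p assms(2)] by (subst cong_int_iff)
  hence "rat_cong (of_int (int (k ^ (p - 1)))) (of_int (int 1)) p"
    by (rule rat_cong_of_int)
  hence 1: "rat_cong (of_nat k ^ (p - 1)) 1 p"
    by simp
  have "1 / of_nat k ^ 2 \<in> padic_int_rats p"
    using padic_int_rats_power[OF padic_int_rats_inverse[OF assms(2)], of 2]
    by (simp add: power_one_over)
  from rat_cong_cmult[OF 1 this]
  have "rat_cong (1 / of_nat k ^ 2 * of_nat k ^ (p - 1)) (1 / of_nat k ^ 2) p"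
    by simp
  also have "p - 1 = 2 + (p - 3)"
    using assms(1) by simp
  also have "of_nat k ^ (2 + (p - 3)) = (of_nat k ^ 2 * of_nat k ^ (p - 3) :: rat)"
    by (rule power_add)
  also have "1 / of_nat k ^ 2 * \<dots> = (of_nat k ^ (p - 3) :: rat)"
    using assms(2) by (cases "k = 0") simp_all
  finally show ?thesis
    by (rule rat_cong_sym)
qed

text \<open>Multiplying out and dropping the terms of degree at least two in \<open>y\<close>.\<close>

lemma prod_one_plus_expansion:
  assumes "finite I" "y \<in> padic_int_rats p" "\<And>i. i \<in> I \<Longrightarrow> c i \<in> padic_int_rats p"
  shows "\<exists>z \<in> padic_int_rats p. (\<Prod>i\<in>I. 1 + y * c i) = 1 + y * (\<Sum>i\<in>I. c i) + y ^ 2 * z"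
  using assms
proof (induction I rule: finite_induct)
  case empty
  thus ?case by (intro bexI[of _ 0]) auto
next
  case (insert a I)
  then obtain z where z: "z \<in> padic_int_rats p"
    "(\<Prod>i\<in>I. 1 + y * c i) = 1 + y * (\<Sum>i\<in>I. c i) + y ^ 2 * z"
    by auto
  have "c a * sum c I + (1 + y * c a) * z \<in> padic_int_rats p"
    using insert.prems z(1)
    by (intro padic_int_rats_add padic_int_rats_mult padic_int_rats_sum) auto
  moreover have "(\<Prod>i\<in>insert a I. 1 + y * c i) =
      1 + y * (\<Sum>i\<in>insert a I. c i) + y ^ 2 * (c a * sum c I + (1 + y * c a) * z)"
    using insert.hyps z(2) by (simp add: algebra_simps power2_eq_square)
  ultimately show ?case
    by blast
qed

end

section \<open>Bernoulli polynomials\<close>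

lemma fps_exp_minus_one_nonzero: "fps_exp 1 - 1 \<noteq> (0 :: 'a :: field_char_0 fps)"
proof -
  have "fps_nth (fps_exp 1 - 1 :: 'a fps) 1 \<noteq> 0" by simp
  thus ?thesis by force
qed

lemma bernpoly_gf_unique:
  assumes "F * (fps_exp 1 - 1) = fps_X * fps_exp (x :: 'a :: field_char_0)"
  shows "F = Abs_fps (\<lambda>m. bernpoly m x / fact m)"
  using assms bernpoly_generating_function[of x] fps_exp_minus_one_nonzero
  by (metis mult_right_cancel)

text \<open>The generating functions at \<open>x + 1\<close> and \<open>x\<close> differ by \<open>t e\<^sup>x\<^sup>t (e\<^sup>t - 1) / (e\<^sup>t - 1)\<close>.\<close>

lemma bernpoly_add_one:
  assumes "m > 0"
  shows "bernpoly m (x + 1) - bernpoly m x = of_nat m * (x :: 'a :: field_char_0) ^ (m - 1)"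
proof -
  let ?G = "\<lambda>x :: 'a. Abs_fps (\<lambda>m. bernpoly m x / fact m)"
  have "(?G x + fps_X * fps_exp x) * (fps_exp 1 - 1) = fps_X * fps_exp (x + 1)"
    unfolding distrib_right bernpoly_generating_function fps_exp_add_mult
    by (simp add: algebra_simps)
  hence "?G (x + 1) = ?G x + fps_X * fps_exp x"
    by (rule bernpoly_gf_unique[symmetric])
  from arg_cong[OF this, of "\<lambda>F. fps_nth F m"] assms show ?thesis
    by (simp add: field_simps fact_reduce[of m])
qed

lemma sum_powers_bernpoly:
  assumes "m > 0"
  shows "of_nat m * (\<Sum>k<n. of_nat k ^ (m - 1)) =
    bernpoly m (of_nat n) - bernpoly m (0 :: 'a :: field_char_0)"
proof (induction n)
  case (Suc n)
  have "bernpoly m (of_nat (Suc n)) - bernpoly m (of_nat n) =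
      of_nat m * (of_nat n :: 'a) ^ (m - 1)"
    using bernpoly_add_one[OF assms, of "of_nat n :: 'a"] by (simp add: add.commute)
  with Suc show ?case
    by (simp add: algebra_simps)
qed simp

text \<open>The generating function at \<open>x\<close> is the one at \<open>0\<close> times \<open>e\<^sup>x\<^sup>t\<close>.\<close>

lemma bernpoly_expansion:
  "bernpoly m x = (\<Sum>k\<le>m. of_nat (m choose k) * bernpoly k 0 * (x :: 'a :: field_char_0) ^ (m - k))"
proof -
  let ?G = "\<lambda>x :: 'a. Abs_fps (\<lambda>m. bernpoly m x / fact m)"
  have "(?G 0 * fps_exp x) * (fps_exp 1 - 1) = ?G 0 * (fps_exp 1 - 1) * fps_exp x"
    by (simp only: mult_ac)
  also have "\<dots> = fps_X * fps_exp x"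
    unfolding bernpoly_generating_function by simp
  finally have "?G x = ?G 0 * fps_exp x"
    by (rule bernpoly_gf_unique[symmetric])
  from arg_cong[OF this, of "\<lambda>F. fact m * fps_nth F m"]
  have "bernpoly m x = fact m * (\<Sum>k=0..m. bernpoly k 0 / fact k * (x ^ (m - k) / fact (m - k)))"
    by (simp add: fps_mult_nth)
  also have "\<dots> = (\<Sum>k\<le>m. of_nat (m choose k) * bernpoly k 0 * x ^ (m - k))"
    unfolding sum_distrib_left atMost_atLeast0
    by (intro sum.cong) (auto simp: binomial_fact)
  finally show ?thesis .
qed

text \<open>
  Substituting \<open>-t\<close> for \<open>t\<close> turns \<open>t e\<^sup>x\<^sup>t / (e\<^sup>t - 1)\<close> into \<open>t e\<^sup>(\<^sup>1\<^sup>-\<^sup>x\<^sup>)\<^sup>t / (e\<^sup>t - 1)\<close>.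
\<close>

lemma bernpoly_reflection:
  "bernpoly m (1 - x) = (-1) ^ m * bernpoly m (x :: 'a :: field_char_0)"
proof -
  let ?G = "\<lambda>x :: 'a. Abs_fps (\<lambda>m. bernpoly m x / fact m)"
  have "(?G x * (fps_exp 1 - 1)) oo - fps_X = (fps_X * fps_exp x) oo - fps_X"
    by (simp only: bernpoly_generating_function)
  hence "(?G x oo - fps_X) * (fps_exp (-1) - 1) = - fps_X * fps_exp (- x)"
    by (simp add: fps_compose_mult_distrib fps_compose_sub_distrib fps_exp_compose_linear)
  hence "(?G x oo - fps_X) * (fps_exp (-1) - 1) * fps_exp 1 = - fps_X * fps_exp (- x) * fps_exp 1"
    by simp
  moreover have "(fps_exp (-1) - 1) * fps_exp 1 = (1 - fps_exp 1 :: 'a fps)"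
    by (simp add: algebra_simps flip: fps_exp_add_mult)
  moreover have "fps_exp (- x) * fps_exp 1 = fps_exp (1 - x)"
    by (simp flip: fps_exp_add_mult)
  ultimately have "(?G x oo - fps_X) * (1 - fps_exp 1) = - fps_X * fps_exp (1 - x)"
    by (simp only: mult.assoc)
  hence "(?G x oo - fps_X) * (fps_exp 1 - 1) = fps_X * fps_exp (1 - x)"
    by (simp add: algebra_simps)
  hence "?G (1 - x) = ?G x oo - fps_X"
    by (rule bernpoly_gf_unique[symmetric])
  from arg_cong[OF this, of "\<lambda>F. fps_nth F m"] show ?thesis
    by (simp add: fps_compose_uminus' field_simps)
qed


section \<open>Bernoulli polynomials and inverse squares modulo a prime\<close>

context
  fixes p :: nat
  assumes prime_p: "prime p" and p_gt_3: "p > 3"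
begin

lemmas padic_int_rats_simps [simp] =
  padic_int_rats_of_int[OF prime_p] padic_int_rats_of_nat[OF prime_p]
  padic_int_rats_numeral[OF prime_p]

lemmas padic_int_rats_intros =
  padic_int_rats_add[OF prime_p] padic_int_rats_diff[OF prime_p] padic_int_rats_mult[OF prime_p]
  padic_int_rats_power[OF prime_p] padic_int_rats_sum[OF prime_p]

lemma padic_int_rats_half_third:
  "1 / 2 \<in> padic_int_rats p" "1 / 3 \<in> padic_int_rats p"
proof -
  have "\<not> p dvd 2" "\<not> p dvd 3"
    using p_gt_3 by (auto dest: dvd_imp_le)
  thus "1 / 2 \<in> padic_int_rats p" "1 / 3 \<in> padic_int_rats p"
    using padic_int_rats_inverse[OF prime_p, of 2] padic_int_rats_inverse[OF prime_p, of 3]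
    by simp_all
qed

text \<open>
  The recursion for the Bernoulli numbers divides by \<open>m + 1\<close> when it computes the \<open>m\<close>-th one, so
  \<open>p\<close> cannot enter a denominator before \<open>m = p - 1\<close>.
\<close>

lemma bernpoly_0_padic_int: "m < p - 1 \<Longrightarrow> bernpoly m 0 \<in> padic_int_rats p"
proof (induction m rule: less_induct)
  case (less m)
  let ?f = "\<lambda>k. of_nat (Suc m choose k) * bernpoly k 0 :: rat"
  have "bernpoly (Suc m) 1 - bernpoly (Suc m) 0 = of_nat (Suc m) * (0 :: rat) ^ m"
    using bernpoly_add_one[of "Suc m" "0 :: rat"] by simp
  moreover have "bernpoly (Suc m) 1 = (\<Sum>k<m. ?f k) + of_nat (Suc m) * bernpoly m 0 + bernpoly (Suc m) 0"
    by (subst bernpoly_expansion) (simp add: lessThan_Suc_atMost[symmetric])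
  ultimately have "of_nat (Suc m) * bernpoly m 0 = of_nat (Suc m) * 0 ^ m - (\<Sum>k<m. ?f k)"
    by simp
  moreover have "\<dots> \<in> padic_int_rats p"
    using less by (intro padic_int_rats_intros) (auto simp del: of_nat_Suc)
  moreover have "\<not> p dvd Suc m"
    using less.prems by (auto dest: dvd_imp_le)
  ultimately have "of_nat (Suc m) * bernpoly m 0 / of_nat (Suc m) \<in> padic_int_rats p"
    using padic_int_rats_divide[OF prime_p] by metis
  thus ?case
    by (simp del: of_nat_Suc)
qed

lemma bernpoly_cong:
  assumes "m < p - 1" "rat_cong x y p" "x \<in> padic_int_rats p" "y \<in> padic_int_rats p"
  shows "rat_cong (bernpoly m x) (bernpoly m y) p"
  unfolding bernpoly_expansion[of m x] bernpoly_expansion[of m y]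
  using assms bernpoly_0_padic_int
  by (intro rat_cong_sum[OF prime_p] rat_cong_cmult[OF prime_p] rat_cong_power[OF prime_p]
      padic_int_rats_intros) auto

lemma not_dvd_between: "1 \<le> k \<Longrightarrow> k < p \<Longrightarrow> \<not> p dvd k"
  by (auto dest: dvd_imp_le)

lemma inverse_square_padic_int: "\<not> p dvd k \<Longrightarrow> 1 / of_nat k ^ 2 \<in> padic_int_rats p"
  using padic_int_rats_power[OF prime_p padic_int_rats_inverse[OF prime_p, of k], of 2]
  by (simp add: power_one_over)

text \<open>
  By Fermat's theorem the inverse squares are the powers with exponent \<open>p - 3\<close>, whose sums are
  values of the Bernoulli polynomial of degree \<open>p - 2\<close>; since its coefficients are integral at
  \<open>p\<close>, the end point only matters modulo \<open>p\<close>.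
\<close>

lemma sum_inverse_squares_cong:
  assumes "N \<le> p" "rat_cong (of_nat N) x p" "x \<in> padic_int_rats p"
  shows "rat_cong (\<Sum>k=1..<N. 1 / of_nat k ^ 2)
    (- (1 / 2) * (bernpoly (p - 2) x - bernpoly (p - 2) 0)) p"
proof -
  let ?S = "\<Sum>k<N. of_nat k ^ (p - 3) :: rat"
  have "(\<Sum>k=1..<N. of_nat k ^ (p - 3) :: rat) = ?S"
    using p_gt_3 by (intro sum.mono_neutral_left) auto
  moreover have "rat_cong (\<Sum>k=1..<N. 1 / of_nat k ^ 2) (\<Sum>k=1..<N. of_nat k ^ (p - 3)) p"
    using assms(1) p_gt_3 not_dvd_between
    by (intro rat_cong_sum[OF prime_p] inverse_square_cong_power[OF prime_p]) auto
  ultimately have 1: "rat_cong (\<Sum>k=1..<N. 1 / of_nat k ^ 2) ?S p"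
    by simp
  \<comment> \<open>The factor \<open>p - 2\<close> of the power sum formula is \<open>-2\<close> modulo \<open>p\<close>.\<close>
  have 2: "rat_cong ?S (- (1 / 2) * (of_nat (p - 2) * ?S)) p"
  proof (rule rat_congI[OF prime_p])
    show "?S - - (1 / 2) * (of_nat (p - 2) * ?S) = of_nat p * (1 / 2 * ?S)"
      using p_gt_3 by (simp add: of_nat_diff algebra_simps)
    show "1 / 2 * ?S \<in> padic_int_rats p"
      using padic_int_rats_half_third by (intro padic_int_rats_intros) auto
  qed
  have "of_nat (p - 2) * ?S = bernpoly (p - 2) (of_nat N) - bernpoly (p - 2) 0"
    using sum_powers_bernpoly[of "p - 2" N, where 'a = rat] p_gt_3
    by (simp add: numeral_eq_Suc)
  moreover have "rat_cong (bernpoly (p - 2) (of_nat N)) (bernpoly (p - 2) x) p"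
    using assms p_gt_3 by (intro bernpoly_cong) auto
  ultimately have "rat_cong (of_nat (p - 2) * ?S) (bernpoly (p - 2) x - bernpoly (p - 2) 0) p"
    using rat_cong_diff[OF prime_p] rat_cong_refl[OF prime_p] by metis
  moreover have "- (1 / 2) \<in> padic_int_rats p"
    using padic_int_rats_half_third padic_int_rats_uminus[OF prime_p] by blast
  ultimately have 3: "rat_cong (- (1 / 2) * (of_nat (p - 2) * ?S))
      (- (1 / 2) * (bernpoly (p - 2) x - bernpoly (p - 2) 0)) p"
    by (rule rat_cong_cmult[OF prime_p])
  show ?thesis
    using 1 2 3 rat_cong_trans[OF prime_p] by blast
qed

lemma sum_all_inverse_squares_cong_0: "rat_cong (\<Sum>k=1..<p. 1 / of_nat k ^ 2) 0 p"
proof -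
  have "rat_cong (of_nat p) 0 p"
    by (rule rat_congI[OF prime_p, of 1]) auto
  from sum_inverse_squares_cong[OF _ this] show ?thesis
    by simp
qed

end

section \<open>Binomial coefficients with both arguments multiplied by a prime\<close>

lemma binomial_prod_fractions:
  "of_nat ((m + k) choose k) = (\<Prod>i=1..k. of_nat (m + i) / of_nat i :: rat)"
proof (induction k)
  case (Suc k)
  have "of_nat (Suc k) * of_nat ((m + Suc k) choose Suc k) =
      (of_nat (Suc (m + k)) * of_nat ((m + k) choose k) :: rat)"
    by (metis Suc_times_binomial add_Suc_right of_nat_mult)
  with Suc show ?case
    by (simp add: field_simps del: binomial_Suc_Suc)
qed simp

text \<open>
  In the product formula for \<open>p (m + j) choose p j\<close>, the factors whose index is a multiple of \<open>p\<close>
  cancel to those of \<open>m + j choose j\<close>.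
\<close>

lemma binomial_prime_multiple_prod:
  fixes p :: nat
  assumes "p > 0"
  shows "of_nat (p * (m + j) choose (p * j)) =
    of_nat ((m + j) choose j) * (\<Prod>i | i < p * j \<and> \<not> p dvd i. of_nat (p * m + i) / of_nat i :: rat)"
proof -
  let ?I = "{i. i < p * j \<and> \<not> p dvd i}"
  let ?f = "\<lambda>i. of_nat (p * m + i) / of_nat i :: rat"
  have set: "{1..p * j} = (*) p ` {1..j} \<union> ?I"
  proof (intro equalityI subsetI)
    fix i assume i: "i \<in> {1..p * j}"
    show "i \<in> (*) p ` {1..j} \<union> ?I"
    proof (cases "p dvd i")
      case True
      then obtain l where "i = p * l" ..
      with i assms show ?thesis
        by (auto intro!: imageI)
    next
      case False
      hence "i \<noteq> p * j"
        by auto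
      with i False show ?thesis
        by auto
    qed
  next
    fix i assume "i \<in> (*) p ` {1..j} \<union> ?I"
    thus "i \<in> {1..p * j}"
      using assms by (auto intro!: Suc_leI Nat.gr0I)
  qed
  have "of_nat (p * (m + j) choose (p * j)) = prod ?f {1..p * j}"
    using binomial_prod_fractions[of "p * m" "p * j"] by (simp add: distrib_left)
  also have "\<dots> = prod ?f ((*) p ` {1..j}) * prod ?f ?I"
    unfolding set by (intro prod.union_disjoint) auto
  also have "prod ?f ((*) p ` {1..j}) = (\<Prod>l=1..j. ?f (p * l))"
    using assms by (subst prod.reindex) (auto simp: inj_on_def)
  also have "\<dots> = (\<Prod>l=1..j. of_nat (m + l) / of_nat l)"
    using assms by (intro prod.cong) (auto simp: field_simps)
  also have "\<dots> = of_nat ((m + j) choose j)"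
    by (rule binomial_prod_fractions[symmetric])
  finally show ?thesis .
qed

lemma sum_lessThan_residues:
  fixes p :: nat
  assumes "p > 0"
  shows "(\<Sum>k<p * n. f k) = (\<Sum>j<n. f (p * j)) + (\<Sum>j<n. \<Sum>r=1..<p. f (p * j + r))"
proof -
  have "(\<Sum>k<p * n. f k) = (\<Sum>j<n. sum f {j * p..<j * p + p})"
    by (simp add: sum.nat_group mult.commute)
  also have "\<dots> = (\<Sum>j<n. f (p * j) + (\<Sum>r=1..<p. f (p * j + r)))"
  proof (intro sum.cong refl)
    fix j
    have "sum f {j * p..<j * p + p} = (\<Sum>r=0..<p. f (p * j + r))"
      using sum.shift_bounds_nat_ivl[of f 0 "j * p" p] by (simp add: ac_simps)
    also have "\<dots> = f (p * j) + (\<Sum>r=1..<p. f (p * j + r))"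
      using assms by (subst sum.atLeast_Suc_lessThan) auto
    finally show "sum f {j * p..<j * p + p} = f (p * j) + (\<Sum>r=1..<p. f (p * j + r))" .
  qed
  finally show ?thesis
    by (simp add: sum.distrib)
qed

context
  fixes p :: nat
  assumes prime_p: "prime p" and p_gt_3: "p > 3"
begin

lemma sum_inverse_squares_coprime_cong_0:
  "rat_cong (\<Sum>i | i < p * j \<and> \<not> p dvd i. 1 / of_nat i ^ 2) 0 p"
proof -
  let ?f = "\<lambda>i. if p dvd i then 0 else 1 / of_nat i ^ 2 :: rat"
  have "(\<Sum>i | i < p * j \<and> \<not> p dvd i. 1 / of_nat i ^ 2) = (\<Sum>i<p * j. ?f i)"
    by (intro sum.mono_neutral_cong_left) auto
  also have "\<dots> = (\<Sum>l<j. \<Sum>r=1..<p. ?f (p * l + r))"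
    using p_gt_3 by (subst sum_lessThan_residues) auto
  finally have eq: "(\<Sum>i | i < p * j \<and> \<not> p dvd i. 1 / of_nat i ^ 2) = \<dots>" .
  have "rat_cong (\<Sum>l<j. \<Sum>r=1..<p. ?f (p * l + r)) (\<Sum>l<j. \<Sum>r=1..<p. 1 / of_nat r ^ 2) p"
  proof (intro rat_cong_sum[OF prime_p])
    fix l r assume "r \<in> {1..<p}"
    hence r: "\<not> p dvd r"
      using not_dvd_between[OF prime_p p_gt_3] by simp
    have "[int ((p * l + r) ^ 2) = int (r ^ 2)] (mod int p)"
      unfolding cong_int_iff by (intro cong_pow) (simp add: cong_def)
    moreover have "\<not> int p dvd int ((p * l + r) ^ 2)"
      unfolding int_dvd_int_iff using r prime_p
      by (auto simp: prime_dvd_power_iff dvd_add_right_iff)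
    ultimately have "rat_cong (1 / of_int (int ((p * l + r) ^ 2))) (1 / of_int (int (r ^ 2))) p"
      by (rule rat_cong_inverse[OF prime_p])
    thus "rat_cong (?f (p * l + r)) (1 / of_nat r ^ 2) p"
      using r by (simp add: dvd_add_right_iff)
  qed
  moreover have "rat_cong (\<Sum>l<j. \<Sum>r=1..<p. 1 / of_nat r ^ 2) (\<Sum>l<j. 0) p"
    by (intro rat_cong_sum[OF prime_p] sum_all_inverse_squares_cong_0[OF prime_p p_gt_3])
  ultimately have "rat_cong (\<Sum>l<j. \<Sum>r=1..<p. ?f (p * l + r)) (\<Sum>l<j. 0) p"
    by (rule rat_cong_trans[OF prime_p])
  thus ?thesis
    unfolding eq by (simp only: sum.neutral_const)
qed

text \<open>
  Reflecting \<open>i\<close> to \<open>p j - i\<close> in one copy of the product pairs up the factors of the square: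
  \<open>(p m + i) (p m + p j - i) = i (p j - i) + p\<^sup>2 m (m + j)\<close>. To first order the square is thus \<open>1\<close>
  plus \<open>p\<^sup>2 m (m + j)\<close> times the sum of \<open>1 / (i (p j - i))\<close>, which is minus the sum of the inverse
  squares modulo \<open>p\<close> and so provides the third factor \<open>p\<close>. The square is easier than the product
  itself, where one would have to choose one \<open>i\<close> from each pair.
\<close>

lemma prime_multiple_prod_square:
  "\<exists>u \<in> padic_int_rats p.
    (\<Prod>i | i < p * j \<and> \<not> p dvd i. of_nat (p * m + i) / of_nat i :: rat) ^ 2 =
      1 + of_nat p ^ 3 * of_nat m * of_nat (m + j) * u"
proof -
  let ?I = "{i. i < p * j \<and> \<not> p dvd i}"
  let ?f = "\<lambda>i. of_nat (p * m + i) / of_nat i :: rat"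
  define c where "c i = (1 / (of_nat i * of_nat (p * j - i)) :: rat)" for i
  define y where "y = (of_nat p ^ 2 * of_nat m * of_nat (m + j) :: rat)"
  have fin: "finite ?I"
    by simp
  have not_dvd: "\<not> p dvd p * j - i" if "i \<in> ?I" for i
    using that dvd_diffD1[of p "p * j" i] by auto
  have "p * j - i \<in> ?I" if "i \<in> ?I" for i
    using that not_dvd[OF that] by (cases "i = 0") auto
  hence bij: "bij_betw (\<lambda>i. p * j - i) ?I ?I"
    by (intro bij_betwI[of _ _ _ "\<lambda>i. p * j - i"]) auto
  have "prod ?f ?I ^ 2 = prod ?f ?I * (\<Prod>i\<in>?I. ?f (p * j - i))"
    using prod.reindex_bij_betw[OF bij, of ?f] by (simp add: power2_eq_square)
  also have "\<dots> = (\<Prod>i\<in>?I. 1 + y * c i)"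
    unfolding prod.distrib[symmetric]
  proof (intro prod.cong refl)
    fix i assume i: "i \<in> ?I"
    let ?x = "of_nat i :: rat" and ?d = "of_nat (p * j - i) :: rat"
    have nz: "?x \<noteq> 0" "?d \<noteq> 0"
      using i by (auto intro!: Nat.gr0I simp del: of_nat_diff)
    have "?x + ?d = of_nat (i + (p * j - i))"
      by (rule of_nat_add[symmetric])
    also have "\<dots> = of_nat p * of_nat j"
      using i by simp
    finally have d: "?x + ?d = of_nat p * of_nat j" .
    have "of_nat (p * m + i) * of_nat (p * m + (p * j - i)) =
        ?x * ?d + of_nat p * of_nat m * (of_nat p * of_nat m + (?x + ?d))"
      by (simp add: algebra_simps del: of_nat_diff)
    also have "\<dots> = ?x * ?d + y"
      unfolding d y_def by (simp add: algebra_simps power2_eq_square)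
    finally have "?f i * ?f (p * j - i) = (?x * ?d + y) / (?x * ?d)"
      by (simp only: times_divide_times_eq)
    also have "\<dots> = 1 + y * c i"
      using nz by (simp add: c_def add_divide_distrib del: of_nat_diff)
    finally show "?f i * ?f (p * j - i) = 1 + y * c i" .
  qed
  finally have sq: "prod ?f ?I ^ 2 = (\<Prod>i\<in>?I. 1 + y * c i)" .
  have c_int: "c i \<in> padic_int_rats p" if "i \<in> ?I" for i
    using padic_int_rats_mult[OF prime_p padic_int_rats_inverse[OF prime_p, of i]
        padic_int_rats_inverse[OF prime_p, of "p * j - i"]] that not_dvd[OF that]
    by (simp add: c_def)
  have y_int: "y \<in> padic_int_rats p"
    unfolding y_def using padic_int_rats_of_nat[OF prime_p, of "p ^ 2 * m * (m + j)"] by simp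
  obtain z where z: "z \<in> padic_int_rats p"
      "(\<Prod>i\<in>?I. 1 + y * c i) = 1 + y * sum c ?I + y ^ 2 * z"
    using prod_one_plus_expansion[OF prime_p fin y_int, of c] c_int by blast
  have "rat_cong (sum c ?I) (\<Sum>i\<in>?I. - 1 * (1 / of_nat i ^ 2)) p"
  proof (intro rat_cong_sum[OF prime_p])
    fix i assume i: "i \<in> ?I"
    have "int i * int (p * j - i) - (- (int i ^ 2)) = int p * (int j * int i)"
      using i by (simp add: of_nat_diff algebra_simps power2_eq_square)
    hence "[int i * int (p * j - i) = - (int i ^ 2)] (mod int p)"
      by (simp add: cong_iff_dvd_diff)
    moreover have "\<not> int p dvd int i * int (p * j - i)"
      using i not_dvd[OF i] prime_p by (simp add: prime_dvd_mult_iff del: of_nat_diff)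
    ultimately have "rat_cong (1 / of_int (int i * int (p * j - i))) (1 / of_int (- (int i ^ 2))) p"
      by (rule rat_cong_inverse[OF prime_p])
    thus "rat_cong (c i) (- 1 * (1 / of_nat i ^ 2)) p"
      by (simp add: c_def)
  qed
  also have "(\<Sum>i\<in>?I. - 1 * (1 / of_nat i ^ 2)) = (- 1 :: rat) * (\<Sum>i\<in>?I. 1 / of_nat i ^ 2)"
    by (rule sum_distrib_left[symmetric])
  finally have "rat_cong (sum c ?I) (- 1 * (\<Sum>i\<in>?I. 1 / of_nat i ^ 2)) p" .
  moreover have "rat_cong (- 1 * (\<Sum>i\<in>?I. 1 / of_nat i ^ 2)) (- 1 * 0) p"
    using padic_int_rats_of_int[OF prime_p, of "-1"]
    by (intro rat_cong_cmult[OF prime_p] sum_inverse_squares_coprime_cong_0) simp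
  ultimately have "rat_cong (sum c ?I) (- 1 * 0) p"
    by (rule rat_cong_trans[OF prime_p])
  then obtain v where v: "v \<in> padic_int_rats p" "sum c ?I = of_nat p * v"
    by (auto simp: rat_cong_def)
  have "y ^ 2 = of_nat p ^ 3 * of_nat m * of_nat (m + j) * of_nat (p * m * (m + j))"
    by (simp add: y_def power2_eq_square power3_eq_cube)
  hence "prod ?f ?I ^ 2 =
      1 + of_nat p ^ 3 * of_nat m * of_nat (m + j) * (v + of_nat (p * m * (m + j)) * z)"
    unfolding sq z(2) v(2) by (simp add: y_def algebra_simps power2_eq_square power3_eq_cube)
  moreover have "v + of_nat (p * m * (m + j)) * z \<in> padic_int_rats p"
    using v z padic_int_rats_of_nat[OF prime_p]
    by (intro padic_int_rats_add[OF prime_p] padic_int_rats_mult[OF prime_p])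
  ultimately show ?thesis
    by blast
qed

lemma binomial_prime_multiple_square:
  assumes "j \<le> n"
  shows "\<exists>u \<in> padic_int_rats p. of_nat (p * n choose (p * j)) ^ 2 =
    of_nat (n choose j) ^ 2 * (1 + of_nat p ^ 3 * of_nat (n - j) * of_nat n * u)"
proof -
  obtain u where u: "u \<in> padic_int_rats p"
    "(\<Prod>i | i < p * j \<and> \<not> p dvd i. of_nat (p * (n - j) + i) / of_nat i :: rat) ^ 2 =
      1 + of_nat p ^ 3 * of_nat (n - j) * of_nat (n - j + j) * u"
    using prime_multiple_prod_square by blast
  moreover have "of_nat (p * n choose (p * j)) = of_nat (n choose j) *
      (\<Prod>i | i < p * j \<and> \<not> p dvd i. of_nat (p * (n - j) + i) / of_nat i :: rat)"
    using binomial_prime_multiple_prod[of p "n - j" j] p_gt_3 assms by simp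
  ultimately show ?thesis
    using assms by (auto simp: power_mult_distrib)
qed


text \<open>
  By \<open>(p n - p j) (p n choose p j) = p n (p n - 1 choose p j)\<close> and the same relation for \<open>n\<close> and
  \<open>j\<close>, the ratio of the two sides is the one for \<open>p n choose p j\<close> and \<open>n choose j\<close>.
\<close>

lemma binomial_pred_prime_multiple_square:
  assumes "j < n"
  shows "rat_cong (of_nat (p * n - 1 choose (p * j)) ^ 2) (of_nat (n - 1 choose j) ^ 2) p"
proof -
  let ?A = "of_nat (p * n - 1 choose (p * j)) :: rat"
  let ?B = "of_nat (n - 1 choose j) :: rat"
  obtain u where u: "u \<in> padic_int_rats p" "of_nat (p * n choose (p * j)) ^ 2 =
      of_nat (n choose j) ^ 2 * (1 + of_nat p ^ 3 * of_nat (n - j) * of_nat n * u)"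
    using binomial_prime_multiple_square[of j n] assms by auto
  have "p * ((n - j) * (p * n choose (p * j))) = p * (n * (p * n - 1 choose (p * j)))"
    using binomial_absorb_comp[of "p * n" "p * j"]
    by (simp only: diff_mult_distrib2[symmetric] mult.assoc)
  hence "(n - j) * (p * n choose (p * j)) = n * (p * n - 1 choose (p * j))"
    using p_gt_3 by simp
  hence 1: "of_nat n * ?A = of_nat (n - j) * of_nat (p * n choose (p * j))"
    by (metis of_nat_mult)
  have 2: "of_nat (n - j) * of_nat (n choose j) = of_nat n * ?B"
    using binomial_absorb_comp[of n j] by (metis of_nat_mult)
  have "of_nat n ^ 2 * ?A ^ 2 = (of_nat (n - j) * of_nat (n choose j)) ^ 2 *
      (1 + of_nat p ^ 3 * of_nat (n - j) * of_nat n * u)"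
    using arg_cong[OF 1, of "\<lambda>x. x ^ 2"] u(2) by (simp add: power_mult_distrib)
  also have "\<dots> = of_nat n ^ 2 * (?B ^ 2 * (1 + of_nat p ^ 3 * of_nat (n - j) * of_nat n * u))"
    unfolding 2 by (simp add: power_mult_distrib)
  finally have "?A ^ 2 = ?B ^ 2 * (1 + of_nat p ^ 3 * of_nat (n - j) * of_nat n * u)"
    using assms by simp
  moreover have "?B ^ 2 * (1 + of_nat p ^ 3 * of_nat (n - j) * of_nat n * u) - ?B ^ 2 =
      of_nat p * (of_nat ((n - 1 choose j) ^ 2 * p ^ 2 * (n - j) * n) * u)"
    unfolding of_nat_mult of_nat_power distrib_left
    by (simp add: power2_eq_square power3_eq_cube del: of_nat_diff)
  ultimately have "?A ^ 2 - ?B ^ 2 =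
      of_nat p * (of_nat ((n - 1 choose j) ^ 2 * p ^ 2 * (n - j) * n) * u)"
    by (simp only:)
  thus ?thesis
    by (rule rat_congI[OF prime_p, rotated])
      (intro padic_int_rats_mult[OF prime_p] padic_int_rats_of_nat[OF prime_p] u(1))
qed

text \<open>
  In row \<open>p n - 1\<close>, moving one step to the right multiplies the entry at \<open>k = p j + s\<close> by
  \<open>(p n - 1 - k) / (k + 1)\<close>, which is \<open>-1\<close> modulo \<open>p\<close> as long as \<open>p\<close> does not divide \<open>k + 1\<close>.
\<close>

lemma binomial_pred_square_shift:
  assumes "j < n" "s < p"
  shows "[int (p * n - 1 choose (p * j + s)) ^ 2 = int (p * n - 1 choose (p * j)) ^ 2] (mod int p)"
  using assms(2)
proof (induction s)
  case (Suc s)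
  define k where "k = p * j + s"
  let ?C = "\<lambda>k. int (p * n - 1 choose k)"
  have "p * Suc j \<le> p * n"
    using assms(1) by (intro mult_le_mono) auto
  hence k_le: "k + 2 \<le> p * n"
    using Suc.prems by (simp add: k_def)
  have "Suc k * (p * n - 1 choose Suc k) = (p * n - 1 - k) * (p * n - 1 choose k)"
    using binomial_absorption[of k "p * n - 1"] binomial_absorb_comp[of "p * n - 1" k] by simp
  hence "int (Suc k) * ?C (Suc k) = int (p * n - 1 - k) * ?C k"
    by (metis of_nat_mult)
  hence eq: "int (Suc k) ^ 2 * ?C (Suc k) ^ 2 = int (p * n - 1 - k) ^ 2 * ?C k ^ 2"
    by (metis power_mult_distrib)
  have "int (p * n - 1 - k) = int p * int n - int (Suc k)"
    using k_le by (simp add: of_nat_diff)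
  hence "[int (p * n - 1 - k) = - int (Suc k)] (mod int p)"
    by (simp add: cong_iff_dvd_diff)
  hence "[int (p * n - 1 - k) ^ 2 = (- int (Suc k)) ^ 2] (mod int p)"
    by (rule cong_pow)
  hence "[int (p * n - 1 - k) ^ 2 * ?C k ^ 2 = int (Suc k) ^ 2 * ?C k ^ 2] (mod int p)"
    unfolding power2_minus by (intro cong_mult cong_refl)
  hence "[int (Suc k) ^ 2 * ?C (Suc k) ^ 2 = int (Suc k) ^ 2 * ?C k ^ 2] (mod int p)"
    by (simp only: eq)
  moreover have "coprime (int (Suc k) ^ 2) (int p)"
  proof -
    have "\<not> p dvd Suc s"
      using Suc.prems by (auto dest: dvd_imp_le)
    hence "\<not> p dvd Suc k"
      unfolding k_def by (metis add_Suc_right dvd_add_right_iff dvd_triv_left)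
    hence "coprime p (Suc k)"
      using prime_p by (simp add: prime_imp_coprime)
    hence "coprime (int p) (int (Suc k))"
      by (simp only: coprime_int_iff)
    thus ?thesis
      by (simp add: coprime_commute del: of_nat_Suc)
  qed
  ultimately have "[?C (Suc k) ^ 2 = ?C k ^ 2] (mod int p)"
    using cong_mult_lcancel by blast
  also have "[?C k ^ 2 = ?C (p * j) ^ 2] (mod int p)"
    using Suc unfolding k_def by simp
  finally show ?case
    by (simp add: k_def)
qed simp

lemma binomial_coprime_index_square:
  assumes "j < n" "1 \<le> r" "r < p"
  shows "rat_cong (of_nat (p * n choose (p * j + r)) ^ 2 / of_nat (p * n) ^ 2)
    (of_nat (n - 1 choose j) ^ 2 * (1 / of_nat r ^ 2)) p"
proof -
  let ?k = "p * j + r"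
  let ?C = "of_nat (p * n - 1 choose (p * j + (r - 1))) :: rat"
  have r: "\<not> p dvd r"
    using assms by (auto dest: dvd_imp_le)
  hence k: "\<not> p dvd ?k"
    by (simp add: dvd_add_right_iff)
  have Suc_k: "?k = Suc (p * j + (r - 1))"
    using assms by simp
  have "?k * (p * n choose ?k) = p * n * (p * n - 1 choose (p * j + (r - 1)))"
    unfolding Suc_k by (rule binomial_absorption)
  hence "of_nat ?k * of_nat (p * n choose ?k) = of_nat (p * n) * ?C"
    by (metis of_nat_mult)
  moreover have "of_nat ?k \<noteq> (0 :: rat)" "of_nat (p * n) \<noteq> (0 :: rat)"
    using assms p_gt_3 by (simp_all only: of_nat_eq_0_iff) auto
  ultimately have "of_nat (p * n choose ?k) / of_nat (p * n) = ?C / of_nat ?k"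
    by (simp add: frac_eq_eq mult.commute del: of_nat_mult of_nat_add)
  hence eq: "of_nat (p * n choose ?k) ^ 2 / of_nat (p * n) ^ 2 = ?C ^ 2 * (1 / of_nat ?k ^ 2)"
    by (metis power_divide mult.right_neutral times_divide_eq_right)
  have "rat_cong (of_int (int (p * n - 1 choose (p * j + (r - 1))) ^ 2))
      (of_int (int (p * n - 1 choose (p * j)) ^ 2)) p"
    using assms by (intro rat_cong_of_int[OF prime_p] binomial_pred_square_shift) auto
  hence "rat_cong (?C ^ 2) (of_nat (p * n - 1 choose (p * j)) ^ 2) p"
    by simp
  hence C: "rat_cong (?C ^ 2) (of_nat (n - 1 choose j) ^ 2) p"
    using binomial_pred_prime_multiple_square[OF assms(1)] rat_cong_trans[OF prime_p] by blast
  have "[int (?k ^ 2) = int (r ^ 2)] (mod int p)"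
    unfolding cong_int_iff by (intro cong_pow) (simp add: cong_def)
  moreover have "\<not> int p dvd int (?k ^ 2)"
    unfolding int_dvd_int_iff using k prime_p by (simp add: prime_dvd_power_iff)
  ultimately have "rat_cong (1 / of_int (int (?k ^ 2))) (1 / of_int (int (r ^ 2))) p"
    by (rule rat_cong_inverse[OF prime_p])
  hence "rat_cong (1 / of_nat ?k ^ 2) (1 / of_nat r ^ 2) p"
    by simp
  with C show ?thesis
    unfolding eq using inverse_square_padic_int[OF prime_p p_gt_3 k]
      padic_int_rats_of_nat[OF prime_p, of "(n - 1 choose j) ^ 2"]
    by (intro rat_cong_mult[OF prime_p]) simp_all
qed

text \<open>
  One factor \<open>n - j\<close> from the error term and the two factors \<open>n choose j\<close> together give only one
  \<open>n\<close>; the second one is already present in the error term.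
\<close>

lemma binomial_multiple_index_square:
  assumes "j \<le> n" "n > 0"
  shows "rat_cong ((of_nat (p * n choose (p * j)) ^ 2 - of_nat (n choose j) ^ 2) /
    of_nat (p * n) ^ 2) 0 p"
proof -
  obtain u where u: "u \<in> padic_int_rats p" "of_nat (p * n choose (p * j)) ^ 2 =
      of_nat (n choose j) ^ 2 * (1 + of_nat p ^ 3 * of_nat (n - j) * of_nat n * u)"
    using binomial_prime_multiple_square[OF assms(1)] by auto
  let ?N = "of_nat n :: rat" and ?P = "of_nat p :: rat"
  have abs: "of_nat (n - j) * of_nat (n choose j) = ?N * of_nat (n - 1 choose j)"
    using binomial_absorb_comp[of n j] by (metis of_nat_mult)
  have "of_nat (p * n choose (p * j)) ^ 2 - of_nat (n choose j) ^ 2 =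
      of_nat (n choose j) * (of_nat (n - j) * of_nat (n choose j)) * ?P ^ 3 * ?N * u"
    unfolding u(2) by (simp add: algebra_simps power2_eq_square)
  also have "\<dots> = of_nat (p * n) ^ 2 * (?P * (of_nat ((n choose j) * (n - 1 choose j)) * u))"
    unfolding abs by (simp add: power2_eq_square power3_eq_cube)
  finally have "(of_nat (p * n choose (p * j)) ^ 2 - of_nat (n choose j) ^ 2) / of_nat (p * n) ^ 2 - 0 =
      ?P * (of_nat ((n choose j) * (n - 1 choose j)) * u)"
    using assms p_gt_3 by (simp add: divide_eq_eq)
  thus ?thesis
    by (rule rat_congI[OF prime_p, rotated])
      (intro padic_int_rats_mult[OF prime_p] padic_int_rats_of_nat[OF prime_p] u(1))
qed

end

section \<open>Central trinomial coefficients and cube roots of unity\<close>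

text \<open>
  The trace \<open>w\<^sup>k + w\<^sup>-\<^sup>k\<close> of a power of a primitive cube root of unity \<open>w\<close>, as an integer, so that
  congruences modulo \<open>p\<close> can be taken without leaving the rationals.
\<close>

definition cube_root_trace :: "nat \<Rightarrow> int" where
  "cube_root_trace k = (if 3 dvd k then 2 else -1)"

lemma cube_root_trace_eq_power_sum:
  fixes w :: "'a :: comm_ring_1"
  assumes "w\<^sup>2 + w + 1 = 0"
  shows "of_int (cube_root_trace k) = w ^ k + (w\<^sup>2) ^ k"
proof -
  have w2: "w * w = - w - 1"
    using assms by (simp add: power2_eq_square algebra_simps eq_neg_iff_add_eq_0)
  have w3: "w ^ 3 = 1"
    by (simp add: power3_eq_cube w2 algebra_simps)
  have red: "w ^ k = w ^ (k mod 3)" for k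
  proof -
    have "w ^ k = w ^ (3 * (k div 3) + k mod 3)"
      by simp
    also have "\<dots> = w ^ (k mod 3)"
      by (simp only: power_add power_mult w3) simp
    finally show ?thesis .
  qed
  have eq: "w ^ k + (w\<^sup>2) ^ k = w ^ (k mod 3) + w ^ (2 * (k mod 3) mod 3)"
    unfolding power_mult[symmetric] by (metis red mod_mult_right_eq)
  consider "k mod 3 = 0" | "k mod 3 = 1" | "k mod 3 = 2"
    by linarith
  thus ?thesis
  proof cases
    case 1
    thus ?thesis
      unfolding eq by (simp add: cube_root_trace_def dvd_eq_mod_eq_0)
  next
    case 2
    thus ?thesis
      unfolding eq by (simp add: cube_root_trace_def dvd_eq_mod_eq_0 power2_eq_square w2)
  next
    case 3
    thus ?thesis
      unfolding eq by (simp add: cube_root_trace_def dvd_eq_mod_eq_0 power2_eq_square w2)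
  qed
qed

lemma of_int_coeff_trinomial_power:
  "of_int (poly.coeff ([:1, 1, 1:] ^ m) k) = poly.coeff ([:1, 1, 1 :: 'a :: comm_ring_1:] ^ m) k"
proof (induction m arbitrary: k)
  case (Suc m)
  show ?case
    by (simp add: coeff_pCons Suc split: nat.splits)
qed (simp add: coeff_pCons split: nat.splits)

text \<open>
  The coefficient of \<open>x\<^sup>n\<close> in \<open>(x - w)\<^sup>n (x - w\<^sup>2)\<^sup>n\<close>: the two binomial coefficients of each term are
  \<open>n choose k\<close> and \<open>n choose (n - k)\<close>, whence the square.
\<close>

lemma central_trinomial_cube_root:
  fixes w :: "'a :: comm_ring_1"
  assumes "w\<^sup>2 + w + 1 = 0"
  shows "of_int (central_trinomial n) = (-1) ^ n * (\<Sum>k\<le>n. of_nat (n choose k) ^ 2 * w ^ (n + k))"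
proof -
  have w2: "w * w = - w - 1"
    using assms by (simp add: power2_eq_square algebra_simps eq_neg_iff_add_eq_0)
  have "[:1, 1, 1:] = [:- w, 1:] * [:- (w\<^sup>2), 1:]"
    by (simp add: power2_eq_square w2 algebra_simps)
  hence "of_int (central_trinomial n) = poly.coeff ([:- w, 1:] ^ n * [:- (w\<^sup>2), 1:] ^ n) n"
    unfolding central_trinomial_def of_int_coeff_trinomial_power by (simp only: power_mult_distrib)
  also have "\<dots> = (\<Sum>k\<le>n. (-1) ^ n * (of_nat (n choose k) ^ 2 * w ^ (n + k)))"
    unfolding coeff_mult
  proof (intro sum.cong refl)
    fix k assume "k \<in> {..n}"
    hence k: "k \<le> n"
      by simp
    have c: "poly.coeff ([:a, 1:] ^ n) i = of_nat (n choose i) * a ^ (n - i)"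
      if "i \<le> n" for a :: 'a and i using that
      by (simp add: coeff_linear_poly_power)
    have "(- w) ^ (n - k) * (- (w\<^sup>2)) ^ k = ((-1) ^ (n - k) * (-1) ^ k) * (w ^ (n - k) * w ^ (2 * k))"
      unfolding power_minus[of w] power_minus[of "w\<^sup>2"] by (simp add: power_mult)
    also have "\<dots> = (-1) ^ n * w ^ (n + k)"
      using k by (simp add: add.commute flip: power_add)
    finally have "(- w) ^ (n - k) * (- (w\<^sup>2)) ^ k = (-1) ^ n * w ^ (n + k)" .
    moreover have "n choose (n - k) = n choose k"
      using k by (rule binomial_symmetric[symmetric])
    ultimately show "poly.coeff ([:- w, 1:] ^ n) k * poly.coeff ([:- (w\<^sup>2), 1:] ^ n) (n - k) =
        (-1) ^ n * (of_nat (n choose k) ^ 2 * w ^ (n + k))"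
      using k by (simp add: c power2_eq_square[of "of_nat _"] mult_ac)
  qed
  finally show ?thesis
    by (simp add: sum_distrib_left)
qed

lemma two_central_trinomial:
  "2 * central_trinomial n =
    (-1) ^ n * (\<Sum>k\<le>n. int (n choose k) ^ 2 * cube_root_trace (n + k))"
proof -
  define w where "w = Complex (- 1 / 2) (sqrt 3 / 2)"
  have w: "w\<^sup>2 + w + 1 = 0"
    by (simp add: w_def complex_eq_iff power2_eq_square)
  have w': "(w\<^sup>2)\<^sup>2 + w\<^sup>2 + 1 = 0"
    by (simp add: w_def complex_eq_iff power2_eq_square)
  have "of_int (2 * central_trinomial n) =
      (of_int (central_trinomial n) + of_int (central_trinomial n) :: complex)"
    by simp
  also have "\<dots> = (-1) ^ n * (\<Sum>k\<le>n. of_nat (n choose k) ^ 2 * w ^ (n + k)) +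
      (-1) ^ n * (\<Sum>k\<le>n. of_nat (n choose k) ^ 2 * (w\<^sup>2) ^ (n + k))"
    by (simp only: central_trinomial_cube_root[OF w, symmetric]
        central_trinomial_cube_root[OF w', symmetric])
  also have "\<dots> = (-1) ^ n *
      (\<Sum>k\<le>n. of_nat (n choose k) ^ 2 * of_int (cube_root_trace (n + k)))"
    by (simp only: cube_root_trace_eq_power_sum[OF w] distrib_left sum.distrib)
  also have "\<dots> = of_int ((-1) ^ n * (\<Sum>k\<le>n. int (n choose k) ^ 2 * cube_root_trace (n + k)))"
    by simp
  finally show ?thesis
    by (simp only: of_int_eq_iff)
qed

text \<open>
  This is \<open>e(a) e(b) = e(a + b) + e(- a + b)\<close>, with the natural number \<open>a'\<close> representing \<open>- a\<close>
  modulo \<open>3\<close>.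
\<close>

lemma cube_root_trace_mult:
  assumes "3 dvd a + a'"
  shows "cube_root_trace (a + b) + cube_root_trace (a' + b) = cube_root_trace a * cube_root_trace b"
proof -
  have trace: "cube_root_trace k = (if k mod 3 = 0 then 2 else -1)" for k
    by (simp add: cube_root_trace_def dvd_eq_mod_eq_0)
  have sum: "(c + b) mod 3 = (c mod 3 + b mod 3) mod 3" for c :: nat
    by (rule mod_add_eq[symmetric])
  have residues: "c mod 3 = 0 \<or> c mod 3 = 1 \<or> c mod 3 = 2" for c :: nat
    by linarith
  have "(a mod 3 + a' mod 3) mod 3 = 0"
    using assms by (simp add: mod_add_eq)
  hence "a mod 3 = 0 \<and> a' mod 3 = 0 \<or> a mod 3 = 1 \<and> a' mod 3 = 2 \<or> a mod 3 = 2 \<and> a' mod 3 = 1"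
    using residues[of a] residues[of a'] by (elim disjE) simp_all
  thus ?thesis
    using residues[of b] unfolding trace sum by (elim disjE conjE) simp_all
qed

text \<open>
  The symmetry \<open>j \<mapsto> N - j\<close> keeps the binomial coefficient and negates \<open>N + j\<close> modulo \<open>3\<close>.
  Averaging over it splits off the factor \<open>e(b)\<close>.
\<close>

lemma sum_trace_twisted:
  assumes "\<not> 3 dvd p"
  shows "(\<Sum>j\<le>N. int (N choose j) ^ 2 * cube_root_trace (p * (N + j) + b)) =
    (-1) ^ N * central_trinomial N * cube_root_trace b"
proof -
  let ?c = "\<lambda>j. int (N choose j) ^ 2"
  let ?S = "\<Sum>j\<le>N. ?c j * cube_root_trace (p * (N + j) + b)"
  have "?S = (\<Sum>j\<le>N. ?c (N - j) * cube_root_trace (p * (N + (N - j)) + b))"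
    by (rule sum.reindex_bij_witness[of _ "\<lambda>j. N - j" "\<lambda>j. N - j"]) auto
  also have "\<dots> = (\<Sum>j\<le>N. ?c j * cube_root_trace (p * (N + (N - j)) + b))"
    by (intro sum.cong) (auto simp flip: binomial_symmetric)
  finally have "2 * ?S = (\<Sum>j\<le>N. ?c j * (cube_root_trace (p * (N + j) + b) +
      cube_root_trace (p * (N + (N - j)) + b)))"
    by (simp add: distrib_left sum.distrib)
  also have "\<dots> = (\<Sum>j\<le>N. ?c j * cube_root_trace (N + j)) * cube_root_trace b"
    unfolding sum_distrib_right
  proof (intro sum.cong refl)
    fix j assume "j \<in> {..N}"
    hence "p * (N + j) + p * (N + (N - j)) = 3 * (p * N)"
      by (simp flip: distrib_left)
    hence "3 dvd p * (N + j) + p * (N + (N - j))"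
      by simp
    note cube_root_trace_mult[OF this, of b]
    moreover have "cube_root_trace (p * (N + j)) = cube_root_trace (N + j)"
      using assms prime_dvd_mult_iff[of 3 p "N + j"] by (simp add: cube_root_trace_def)
    ultimately show "?c j * (cube_root_trace (p * (N + j) + b) +
        cube_root_trace (p * (N + (N - j)) + b)) = ?c j * cube_root_trace (N + j) * cube_root_trace b"
      by simp
  qed
  also have "(\<Sum>j\<le>N. ?c j * cube_root_trace (N + j)) = (-1) ^ N * (2 * central_trinomial N)"
    unfolding two_central_trinomial by (simp flip: power_add mult.assoc)
  finally show ?thesis
    by simp
qed

context
  fixes p :: nat
  assumes prime_p: "prime p" and p_gt_3: "p > 3"
begin

lemma three_not_dvd: "\<not> 3 dvd p"
  using prime_p p_gt_3 by (auto simp: prime_nat_iff)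

text \<open>
  The trace is \<open>3 [3 dvd p + r] - 1\<close>, and the sum of all inverse squares vanishes modulo \<open>p\<close>, so only
  the \<open>r = 3 k - p\<close> with \<open>p / 3 < k < 2 p / 3\<close> matter; there \<open>1 / r\<^sup>2\<close> is \<open>1 / (9 k\<^sup>2)\<close> modulo \<open>p\<close>.
  The end points of this range of \<open>k\<close> are \<open>2 / 3\<close> and \<open>1 / 3\<close> modulo \<open>p\<close> in this order if
  \<open>p mod 3 = 1\<close>, and in the opposite order if \<open>p mod 3 = 2\<close>. This accounts for the Legendre symbol.
\<close>

lemma sum_trace_inverse_squares:
  "rat_cong (\<Sum>r=1..<p. of_int (cube_root_trace (p + r)) * (1 / of_nat r ^ 2))
    (- (1 / 3) * of_int (Legendre (int p) 3) * bernpoly (p - 2) (1 / 3)) p"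
proof -
  define A :: "nat \<Rightarrow> rat" where "A N = (\<Sum>k=1..<N. 1 / of_nat k ^ 2)" for N
  let ?B = "\<lambda>x. bernpoly (p - 2) x :: rat"
  define a where "a = p div 3 + 1"
  define b where "b = 2 * p div 3 + 1"
  have ab: "a \<le> b" "b \<le> p" "1 \<le> a"
    using p_gt_3 by (auto simp: a_def b_def)
  have range: "p < 3 * k \<and> 3 * k < 2 * p \<longleftrightarrow> a \<le> k \<and> k < b" for k
  proof -
    have "p < 3 * k \<longleftrightarrow> a \<le> k"
      using div_less_iff_less_mult[of 3 p k] by (simp add: a_def Suc_le_eq mult.commute)
    moreover have "3 * k \<le> 2 * p \<longleftrightarrow> k < b"
      using less_eq_div_iff_mult_less_eq[of 3 k "2 * p"]
      by (simp add: b_def less_Suc_eq_le mult.commute)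
    moreover have "3 * k \<noteq> 2 * p"
      using three_not_dvd by presburger
    ultimately show ?thesis
      by (auto simp: le_less)
  qed
  have "(\<Sum>r=1..<p. of_int (cube_root_trace (p + r)) * (1 / of_nat r ^ 2)) =
      (\<Sum>r=1..<p. 3 * (if 3 dvd p + r then 1 / of_nat r ^ 2 else 0) - 1 / of_nat r ^ 2 :: rat)"
    by (intro sum.cong) (auto simp: cube_root_trace_def)
  also have "\<dots> = 3 * (\<Sum>r | r \<in> {1..<p} \<and> 3 dvd p + r. 1 / of_nat r ^ 2) - A p"
    by (simp add: sum_subtractf sum_distrib_left[symmetric] A_def sum.inter_filter[symmetric])
  also have "(\<Sum>r | r \<in> {1..<p} \<and> 3 dvd p + r. 1 / of_nat r ^ 2 :: rat) =
      (\<Sum>k=a..<b. 1 / of_nat (3 * k - p) ^ 2)"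
    by (rule sum.reindex_bij_witness[of _ "\<lambda>k. 3 * k - p" "\<lambda>r. (p + r) div 3"])
      (auto simp flip: range)
  finally have eq: "(\<Sum>r=1..<p. of_int (cube_root_trace (p + r)) * (1 / of_nat r ^ 2)) =
      3 * (\<Sum>k=a..<b. 1 / of_nat (3 * k - p) ^ 2) - A p" .
  have "rat_cong (\<Sum>k=a..<b. 1 / of_nat (3 * k - p) ^ 2) (\<Sum>k=a..<b. 1 / 9 * (1 / of_nat k ^ 2)) p"
  proof (intro rat_cong_sum[OF prime_p])
    fix k assume "k \<in> {a..<b}"
    hence k: "p < 3 * k" "3 * k < 2 * p"
      using range by auto
    have "int (3 * k - p) = int (3 * k) - int p"
      using k by simp
    hence "[int (3 * k - p) = int (3 * k)] (mod int p)"
      by (simp add: cong_iff_dvd_diff)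
    hence "[int (3 * k - p) ^ 2 = int (3 * k) ^ 2] (mod int p)"
      by (rule cong_pow)
    moreover have "\<not> p dvd 3 * k - p"
      using k by (auto dest!: dvd_imp_le)
    hence "\<not> int p dvd int (3 * k - p) ^ 2"
      unfolding of_nat_power[symmetric] int_dvd_int_iff using prime_p
      by (simp add: prime_dvd_power_iff)
    ultimately have "rat_cong (1 / of_int (int (3 * k - p) ^ 2)) (1 / of_int (int (3 * k) ^ 2)) p"
      by (rule rat_cong_inverse[OF prime_p])
    thus "rat_cong (1 / of_nat (3 * k - p) ^ 2) (1 / 9 * (1 / of_nat k ^ 2)) p"
      by (simp add: power_mult_distrib)
  qed
  also have "(\<Sum>k=a..<b. 1 / 9 * (1 / of_nat k ^ 2)) = 1 / 9 * (A b - A a)"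
    using sum.atLeastLessThan_concat[of 1 a b "\<lambda>k. 1 / of_nat k ^ 2 :: rat"] ab
    by (simp only: sum_distrib_left[symmetric] A_def) simp
  finally have "rat_cong (3 * (\<Sum>k=a..<b. 1 / of_nat (3 * k - p) ^ 2)) (3 * (1 / 9 * (A b - A a))) p"
    by (rule rat_cong_cmult[OF prime_p]) (simp add: padic_int_rats_numeral[OF prime_p])
  from rat_cong_diff[OF prime_p this
      sum_all_inverse_squares_cong_0[OF prime_p p_gt_3, folded A_def]]
  have "rat_cong (3 * (\<Sum>k=a..<b. 1 / of_nat (3 * k - p) ^ 2) - A p) (3 * (1 / 9 * (A b - A a)) - 0) p" .
  moreover have "3 * (1 / 9 * (A b - A a)) - 0 = 1 / 3 * (A b - A a)"
    by simp
  ultimately have 1: "rat_cong (\<Sum>r=1..<p. of_int (cube_root_trace (p + r)) * (1 / of_nat r ^ 2))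
      (1 / 3 * (A b - A a)) p"
    by (simp only: eq)
  have third: "1 / 3 \<in> padic_int_rats p" "2 / 3 \<in> padic_int_rats p"
    using padic_int_rats_half_third[OF prime_p p_gt_3]
      padic_int_rats_mult[OF prime_p padic_int_rats_numeral(3)[OF prime_p, of Num.One], of "1 / 3"]
      padic_int_rats_add[OF prime_p, of "1 / 3" "1 / 3"]
    by simp_all
  have end_point: "rat_cong (A N) (- (1 / 2) * (?B (of_nat c / 3) - ?B 0)) p"
    if "N \<le> p" "3 * N = d * p + c" "c = 1 \<or> c = 2" for N c d
  proof -
    have "of_nat (3 * N) = (of_nat (d * p + c) :: rat)"
      using that(2) by (simp only:)
    hence "of_nat N - of_nat c / 3 = of_nat p * (of_nat d * (1 / 3) :: rat)"
      by (simp add: field_simps)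
    moreover have "of_nat d * (1 / 3) \<in> padic_int_rats p"
      using third by (intro padic_int_rats_mult[OF prime_p] padic_int_rats_of_nat[OF prime_p])
    ultimately have "rat_cong (of_nat N) (of_nat c / 3) p"
      by (intro rat_congI[OF prime_p])
    thus ?thesis
      unfolding A_def using that third
      by (intro sum_inverse_squares_cong[OF prime_p p_gt_3]) auto
  qed
  have odd_p: "odd p"
    using prime_p p_gt_3 by (simp add: prime_odd_nat)
  hence "odd (p - 2)"
    using p_gt_3 by simp
  hence refl: "?B (2 / 3) = - ?B (1 / 3)"
    using bernpoly_reflection[of "p - 2" "1 / 3 :: rat"] by simp
  have "rat_cong (A b - A a) (- of_int (Legendre (int p) 3) * ?B (1 / 3)) p"
  proof (cases "p mod 3 = 1")
    case True
    define t where "t = p div 3"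
    have p: "p = 3 * t + 1"
      using True div_mult_mod_eq[of p 3] by (simp add: t_def)
    have "int p mod 3 = 1"
      using True zmod_int[of p 3] by simp
    hence "QuadRes 3 (int p)" and "\<not> [int p = 0] (mod 3)"
      unfolding QuadRes_def by (auto simp: cong_def intro: exI[of _ 1])
    hence "Legendre (int p) 3 = 1"
      by (simp add: Legendre_def)
    moreover have "3 * a = 1 * p + 2" "3 * b = 2 * p + 1"
      by (simp_all add: a_def b_def p)
    ultimately show ?thesis
      using rat_cong_diff[OF prime_p end_point[of b 2 1] end_point[of a 1 2]] ab refl
      by (simp add: field_simps)
  next
    case False
    hence p2: "p mod 3 = 2"
      using three_not_dvd unfolding dvd_eq_mod_eq_0 by linarith
    define t where "t = p div 3"
    have p: "p = 3 * t + 2"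
      using p2 div_mult_mod_eq[of p 3] by (simp add: t_def)
    have int_p: "int p mod 3 = 2"
      using p2 zmod_int[of p 3] by simp
    have "\<not> [y\<^sup>2 = int p] (mod 3)" for y
    proof -
      have "y mod 3 = 0 \<or> y mod 3 = 1 \<or> y mod 3 = 2"
        by linarith
      hence "y\<^sup>2 mod 3 \<noteq> 2"
        by (subst power_mod[symmetric]) auto
      with int_p show ?thesis
        by (simp add: cong_def)
    qed
    hence "\<not> QuadRes 3 (int p)"
      by (simp add: QuadRes_def)
    moreover have "\<not> [int p = 0] (mod 3)"
      using int_p by (simp add: cong_def)
    ultimately have "Legendre (int p) 3 = -1"
      by (simp add: Legendre_def)
    moreover have "2 * p = 1 + 3 * (2 * t + 1)"
      by (simp add: p)
    hence "2 * p div 3 = 2 * t + 1"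
      by (simp only:) simp
    hence "3 * a = 1 * p + 1" "3 * b = 2 * p + 2"
      by (simp_all add: a_def b_def p)
    ultimately show ?thesis
      using rat_cong_diff[OF prime_p end_point[of b 2 2] end_point[of a 1 1]] ab refl
      by (simp add: field_simps)
  qed
  from rat_cong_cmult[OF prime_p this third(1)]
  have "rat_cong (1 / 3 * (A b - A a)) (- (1 / 3) * of_int (Legendre (int p) 3) * ?B (1 / 3)) p"
    by (simp add: mult.assoc)
  with 1 show ?thesis
    by (rule rat_cong_trans[OF prime_p])
qed

end

theorem theorem1p1:
  fixes p n :: nat
  assumes "prime p" and "p > 3" and "n > 0"
  shows "rat_cong
    ((of_int (central_trinomial (p * n)) - of_int (central_trinomial n)) / (of_nat (p * n))\<^sup>2)
    (of_int (central_trinomial (n - 1)) / 6 * of_int (Legendre (int p) 3) * bernpoly (p - 2) (1 / 3))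
    p"
proof -
  let ?N = "n - 1"
  let ?P = "of_nat (p * n) ^ 2 :: rat"
  let ?e = "\<lambda>k. of_int (cube_root_trace k) :: rat"
  let ?T = "\<lambda>n. of_int (central_trinomial n) :: rat"
  let ?C = "\<lambda>k. of_nat (p * n choose k) ^ 2 :: rat"
  let ?c = "\<lambda>j. of_nat (n choose j) ^ 2 :: rat"
  let ?d = "\<lambda>j. of_nat (?N choose j) ^ 2 :: rat"
  let ?B = "bernpoly (p - 2) (1 / 3) :: rat"
  let ?L = "of_int (Legendre (int p) 3) :: rat"
  note p3 = three_not_dvd[OF assms(1,2)]
  have p0: "p > 0"
    using assms by simp
  have n: "n = Suc ?N"
    using assms by simp
  have odd_p: "odd p"
    using assms by (simp add: prime_odd_nat)
  have T: "2 * ?T m = (-1) ^ m * (\<Sum>k\<le>m. of_nat (m choose k) ^ 2 * ?e (m + k))" for m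
    using arg_cong[OF two_central_trinomial[of m], of "of_int :: int \<Rightarrow> rat"] by simp
  have trace_p: "?e (p * k) = ?e k" for k
    using p3 prime_dvd_mult_iff[of 3 p k] by (simp add: cube_root_trace_def)
  \<comment> \<open>Up to sign, twice the quotient splits into \<open>D1\<close>, from the indices divisible by \<open>p\<close> compared with
    the sum for \<open>n\<close>, and \<open>D2\<close>, from the other indices.\<close>
  define D1 where "D1 = (\<Sum>j\<le>n. ?e (n + j) * ((?C (p * j) - ?c j) / ?P))"
  define D2 where "D2 = (\<Sum>j<n. \<Sum>r=1..<p. ?e (p * n + (p * j + r)) * (?C (p * j + r) / ?P))"
  define X where "X = (\<Sum>k\<le>p * n. ?C k * ?e (p * n + k)) - (\<Sum>j\<le>n. ?c j * ?e (n + j))"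
  have "(\<Sum>k\<le>p * n. ?C k * ?e (p * n + k)) =
      ?C (p * n) * ?e (p * n + p * n) + (\<Sum>k<p * n. ?C k * ?e (p * n + k))"
    by (simp flip: lessThan_Suc_atMost)
  also have "\<dots> = (\<Sum>j\<le>n. ?C (p * j) * ?e (p * n + p * j)) +
      (\<Sum>j<n. \<Sum>r=1..<p. ?C (p * j + r) * ?e (p * n + (p * j + r)))"
    by (subst sum_lessThan_residues[OF p0]) (simp flip: lessThan_Suc_atMost)
  also have "(\<Sum>j\<le>n. ?C (p * j) * ?e (p * n + p * j)) = (\<Sum>j\<le>n. ?C (p * j) * ?e (n + j))"
    by (simp only: trace_p distrib_left[symmetric])
  finally have "X =
      (\<Sum>j\<le>n. ?C (p * j) * ?e (n + j)) - (\<Sum>j\<le>n. ?c j * ?e (n + j)) +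
      (\<Sum>j<n. \<Sum>r=1..<p. ?C (p * j + r) * ?e (p * n + (p * j + r)))"
    unfolding X_def by simp
  also have "\<dots> / ?P = D1 + D2"
    unfolding D1_def D2_def sum_subtractf[symmetric] add_divide_distrib sum_divide_distrib
    by (simp add: algebra_simps diff_divide_distrib)
  finally have D: "X / ?P = D1 + D2" .
  have "(-1) ^ (p * n) = ((-1) ^ n :: rat)"
    using odd_p by (simp add: power_mult)
  hence "2 * (?T (p * n) - ?T n) = (-1) ^ n * X"
    unfolding X_def using T[of "p * n"] T[of n] by (simp only: right_diff_distrib)
  hence "?T (p * n) - ?T n = 1 / 2 * (-1) ^ n * X"
    by simp
  hence "(?T (p * n) - ?T n) / ?P = 1 / 2 * (-1) ^ n * (X / ?P)"
    by (simp only: times_divide_eq_right)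
  hence main: "(?T (p * n) - ?T n) / ?P = 1 / 2 * (-1) ^ n * (D1 + D2)"
    by (simp only: D)
  have "rat_cong D1 (\<Sum>j\<le>n. ?e (n + j) * 0) p"
    unfolding D1_def using assms
    by (intro rat_cong_sum rat_cong_cmult binomial_multiple_index_square padic_int_rats_of_int) auto
  hence D1: "rat_cong D1 0 p"
    by simp
  have "rat_cong D2 (\<Sum>j<n. \<Sum>r=1..<p. ?e (p * n + (p * j + r)) * (?d j * (1 / of_nat r ^ 2))) p"
    unfolding D2_def using assms
    by (intro rat_cong_sum rat_cong_cmult binomial_coprime_index_square padic_int_rats_of_int) auto
  also have "(\<Sum>j<n. \<Sum>r=1..<p. ?e (p * n + (p * j + r)) * (?d j * (1 / of_nat r ^ 2))) =
      (\<Sum>r=1..<p. (\<Sum>j<n. ?d j * ?e (p * n + (p * j + r))) * (1 / of_nat r ^ 2))"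
    by (subst sum.swap) (simp only: sum_distrib_left sum_distrib_right mult_ac)
  also have "\<dots> = (\<Sum>r=1..<p. ((-1) ^ ?N * ?T ?N) * (?e (p + r) * (1 / of_nat r ^ 2)))"
  proof (intro sum.cong refl)
    fix r
    have "p * n + (p * j + r) = p * (?N + j) + (p + r)" for j
      by (subst (1) n) (simp add: algebra_simps)
    moreover have "{..<n} = {..?N}"
      using assms by auto
    ultimately have "(\<Sum>j<n. ?d j * ?e (p * n + (p * j + r))) =
        of_int (\<Sum>j\<le>?N. int (?N choose j) ^ 2 * cube_root_trace (p * (?N + j) + (p + r)))"
      by (simp only: of_int_sum of_int_mult of_int_power of_int_of_nat_eq)
    also have "\<dots> = (-1) ^ ?N * ?T ?N * ?e (p + r)"
      unfolding sum_trace_twisted[OF p3] by simp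
    finally show "(\<Sum>j<n. ?d j * ?e (p * n + (p * j + r))) * (1 / of_nat r ^ 2) =
        ((-1) ^ ?N * ?T ?N) * (?e (p + r) * (1 / of_nat r ^ 2))"
      by simp
  qed
  also have "\<dots> = ((-1) ^ ?N * ?T ?N) * (\<Sum>r=1..<p. ?e (p + r) * (1 / of_nat r ^ 2))"
    by (rule sum_distrib_left[symmetric])
  finally have D2: "rat_cong D2 \<dots> p"
    using assms by simp
  have int: "(-1) ^ m * ?T k \<in> padic_int_rats p" for m k
    using padic_int_rats_of_int[OF assms(1), of "(-1) ^ m * central_trinomial k"] by simp
  have "rat_cong D2 (((-1) ^ ?N * ?T ?N) * (- (1 / 3) * ?L * ?B)) p"
    using D2 rat_cong_cmult[OF assms(1) sum_trace_inverse_squares[OF assms(1,2)] int]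
      rat_cong_trans[OF assms(1)] by blast
  from rat_cong_add[OF assms(1) D1 this]
  have "rat_cong (D1 + D2) (((-1) ^ ?N * ?T ?N) * (- (1 / 3) * ?L * ?B)) p"
    by simp
  moreover have "1 / 2 * (-1) ^ n \<in> padic_int_rats p"
    using padic_int_rats_half_third[OF assms(1,2)] padic_int_rats_of_int[OF assms(1), of "(-1) ^ n"]
    by (intro padic_int_rats_mult[OF assms(1)]) simp_all
  ultimately have "rat_cong (1 / 2 * (-1) ^ n * (D1 + D2))
      (1 / 2 * (-1) ^ n * (((-1) ^ ?N * ?T ?N) * (- (1 / 3) * ?L * ?B))) p"
    using rat_cong_cmult[OF assms(1)] by blast
  moreover have "1 / 2 * (-1) ^ n * (((-1) ^ ?N * ?T ?N) * (- (1 / 3) * ?L * ?B)) =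
      ((-1) ^ n * (-1) ^ ?N) * (- (?T ?N / 6 * ?L * ?B))"
    by simp
  moreover have "(-1) ^ n * (-1) ^ ?N = (- 1 :: rat)"
    by (subst (1) n) (simp flip: power_add mult_2)
  ultimately have "rat_cong (1 / 2 * (-1) ^ n * (D1 + D2)) (- 1 * (- (?T ?N / 6 * ?L * ?B))) p"
    by (simp only:)
  thus ?thesis
    by (simp only: main mult_minus1 minus_minus)
qed

(* The facts that enter the derivation directly. *)
thm_deps theorem1p1

end
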